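(* Let $(X,\varphi)$ be an irreducible Smale space (with $X$ infinite) whose stable sets $X^s(x)$, $x\in X$, are totally disconnected. Then there exists a pair $(\tilde{Y},\tilde{g})$, where $\tilde{Y}$ is a compact (not necessarily Hausdorff) topological space, such that $\tilde{g}:\tilde{Y}\to\tilde{Y}$ is a surjective local homeomorphism that is forward orbit expansive and $(X,\varphi)$ is conjugate to the solenoid associated to $(\tilde{Y},\tilde{g})$.
   Context: A Smale space is a compact metric space $(X,d)$ with a homeomorphism $\varphi:X\to X$, constants $\epsilon_X>0$, $0<\lambda<1$, and a continuous bracket map $[\cdot,\cdot]:\{(x,y): d(x,y)\le\epsilon_X\}\to X$ such that: $[x,x]=x$; $[x,[y,z]]=[x,z]$, $[[x,y],z]=[x,z]$ and $\varphi[x,y]=[\varphi(x),\varphi(y)]$ whenever both sides are defined; $d(\varphi(x),\varphi(y))\le\lambda d(x,y)$ if $[x,y]=y$; and $d(\varphi^{-1}(x),\varphi^{-1}(y))\le\lambda d(x,y)$ if $[x,y]=x$. It is irreducible if for all non-empty open $U,V\subseteq X$ there is $n\ge1$ with $\varphi^n(U)\cap V\neq\emptyset$. The stable set is $X^s(x)=\{y:\lim_{n\to\infty}d(\varphi^n(x),\varphi^n(y))=0\}$, with its locally compact Hausdorff topology in which the sets $X^s(y,\epsilon)=\{z:[y,z]=z,\ d(y,z)<\epsilon\}$, $0<\epsilon\le\epsilon_X$, form a neighbourhood base at $y$. $(\tilde{Y},\tilde{g})$ is forward orbit expansive if there is a finite open cover $\mathcal{U}$ of $\tilde{Y}$ such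 that whenever $x,y\in\tilde{Y}$ are such that for each $n\in\mathbb{N}=\{0,1,\dots\}$ some member of $\mathcal{U}$ contains both $\tilde{g}^n(x)$ and $\tilde{g}^n(y)$, then $x=y$. The solenoid associated to $(\tilde{Y},\tilde{g})$ is $\{(y_n)_{n\in\mathbb{N}}: y_n\in\tilde{Y},\ \tilde{g}(y_{n+1})=y_n\}$ with the subspace topology of the product, together with the homeomorphism $(y_0,y_1,\dots)\mapsto(\tilde{g}(y_0),y_0,y_1,\dots)$. Conjugate means there is a homeomorphism intertwining the two homeomorphisms. *)

theory Defs
  imports "HOL-Analysis.Analysis"
begin

text \<open>
  The bracket is a total function \<open>br\<close>; it is only ever used on pairs at distance at most \<open>\<epsilon>\<close>,
  where it is defined in the mathematical sense. Every axiom is guarded by the definedness of all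
  the brackets occurring in it.
\<close>

locale smale_space = Metric_space X d
  for X :: "'a set" and d :: "'a \<Rightarrow> 'a \<Rightarrow> real" +
  fixes \<phi> :: "'a \<Rightarrow> 'a" and \<epsilon> lam :: real and br :: "'a \<Rightarrow> 'a \<Rightarrow> 'a"
  assumes compact: "compact_space mtopology"
    and homeo: "homeomorphic_map mtopology mtopology \<phi>"
    and eps_pos: "0 < \<epsilon>"
    and lam_pos: "0 < lam" and lam_less_1: "lam < 1"
    and br_continuous:
      "continuous_map
         (subtopology (prod_topology mtopology mtopology) {(x, y). x \<in> X \<and> y \<in> X \<and> d x y \<le> \<epsilon>})
         mtopology (\<lambda>(x, y). br x y)"
    and br_idem: "\<And>x. x \<in> X \<Longrightarrow> br x x = x"
    and br_right:
      "\<And>x y z. \<lbrakk>x \<in> X; y \<in> X; z \<in> X; d y z \<le> \<epsilon>; d x (br y z) \<le> \<epsilon>; d x z \<le> \<epsilon>\<rbrakk>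
         \<Longrightarrow> br x (br y z) = br x z"
    and br_left:
      "\<And>x y z. \<lbrakk>x \<in> X; y \<in> X; z \<in> X; d x y \<le> \<epsilon>; d (br x y) z \<le> \<epsilon>; d x z \<le> \<epsilon>\<rbrakk>
         \<Longrightarrow> br (br x y) z = br x z"
    and br_equivariant:
      "\<And>x y. \<lbrakk>x \<in> X; y \<in> X; d x y \<le> \<epsilon>; d (\<phi> x) (\<phi> y) \<le> \<epsilon>\<rbrakk>
         \<Longrightarrow> \<phi> (br x y) = br (\<phi> x) (\<phi> y)"
    and contract:
      "\<And>x y. \<lbrakk>x \<in> X; y \<in> X; d x y \<le> \<epsilon>; br x y = y\<rbrakk> \<Longrightarrow> d (\<phi> x) (\<phi> y) \<le> lam * d x y"
    and contract_inv:
      "\<And>x y. \<lbrakk>x \<in> X; y \<in> X; d x y \<le> \<epsilon>; br x y = x\<rbrakk>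
         \<Longrightarrow> d (inv_into X \<phi> x) (inv_into X \<phi> y) \<le> lam * d x y"
begin

definition irreducible :: bool where
  "irreducible \<longleftrightarrow>
     (\<forall>U V. openin mtopology U \<and> U \<noteq> {} \<and> openin mtopology V \<and> V \<noteq> {} \<longrightarrow>
        (\<exists>n\<ge>1. (\<phi> ^^ n) ` U \<inter> V \<noteq> {}))"

definition stable_set :: "'a \<Rightarrow> 'a set" where
  "stable_set x = {y \<in> X. (\<lambda>n. d ((\<phi> ^^ n) x) ((\<phi> ^^ n) y)) \<longlonglongrightarrow> 0}"

definition local_stable_set :: "'a \<Rightarrow> real \<Rightarrow> 'a set" where
  "local_stable_set y \<delta> = {z \<in> X. br y z = z \<and> d y z < \<delta>}"

definition stable_open :: "'a \<Rightarrow> 'a set \<Rightarrow> bool" where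
  "stable_open x U \<longleftrightarrow>
     U \<subseteq> stable_set x \<and> (\<forall>y\<in>U. \<exists>\<delta>. 0 < \<delta> \<and> \<delta> \<le> \<epsilon> \<and> local_stable_set y \<delta> \<subseteq> U)"

text \<open>
  The topology on a stable set in which the local stable sets form a neighbourhood base. It is
  determined by this requirement: a set is open iff it contains a basic neighbourhood of each of
  its points.
\<close>

definition stable_topology :: "'a \<Rightarrow> 'a topology" where
  "stable_topology x = topology (stable_open x)"

lemma istopology_stable_open: "istopology (stable_open x)"
  unfolding istopology_def
proof (intro conjI allI impI)
  fix S T
  assume S: "stable_open x S" and T: "stable_open x T"
  have "\<exists>\<delta>. 0 < \<delta> \<and> \<delta> \<le> \<epsilon> \<and> local_stable_set y \<delta> \<subseteq> S \<inter> T" if "y \<in> S \<inter> T" for y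
  proof -
    from S that obtain a where "0 < a" "a \<le> \<epsilon>" "local_stable_set y a \<subseteq> S"
      by (auto simp: stable_open_def)
    moreover from T that obtain b where "0 < b" "b \<le> \<epsilon>" "local_stable_set y b \<subseteq> T"
      by (auto simp: stable_open_def)
    ultimately show ?thesis
      by (intro exI[of _ "min a b"]) (auto simp: local_stable_set_def)
  qed
  with S show "stable_open x (S \<inter> T)"
    by (auto simp: stable_open_def)
next
  fix \<K>
  assume "\<forall>K\<in>\<K>. stable_open x K"
  then have K: "stable_open x K" if "K \<in> \<K>" for K
    using that by simp
  show "stable_open x (\<Union>\<K>)"
    unfolding stable_open_def
  proof (intro conjI ballI)
    show "\<Union>\<K> \<subseteq> stable_set x"
      using K by (auto simp: stable_open_def)
    fix y
    assume "y \<in> \<Union>\<K>"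
    then obtain K where "K \<in> \<K>" "y \<in> K"
      by auto
    moreover from this obtain \<delta> where "0 < \<delta>" "\<delta> \<le> \<epsilon>" "local_stable_set y \<delta> \<subseteq> K"
      using K[of K] by (auto simp: stable_open_def)
    ultimately show "\<exists>\<delta>. 0 < \<delta> \<and> \<delta> \<le> \<epsilon> \<and> local_stable_set y \<delta> \<subseteq> \<Union>\<K>"
      by (intro exI[of _ \<delta>]) auto
  qed
qed

lemma openin_stable_topology [simp]: "openin (stable_topology x) = stable_open x"
  unfolding stable_topology_def by (rule topology_inverse'[OF istopology_stable_open])

end

definition totally_disconnected_space :: "'a topology \<Rightarrow> bool" where
  "totally_disconnected_space T \<longleftrightarrow>
     (\<forall>S. connectedin T S \<longrightarrow> (\<forall>x\<in>S. \<forall>y\<in>S. x = y))"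

definition local_homeomorphism :: "'a topology \<Rightarrow> 'b topology \<Rightarrow> ('a \<Rightarrow> 'b) \<Rightarrow> bool" where
  "local_homeomorphism S T f \<longleftrightarrow>
     f ` topspace S \<subseteq> topspace T \<and>
     (\<forall>x\<in>topspace S. \<exists>U. openin S U \<and> x \<in> U \<and> openin T (f ` U) \<and>
        homeomorphic_map (subtopology S U) (subtopology T (f ` U)) f)"

definition forward_orbit_expansive :: "'a topology \<Rightarrow> ('a \<Rightarrow> 'a) \<Rightarrow> bool" where
  "forward_orbit_expansive Y g \<longleftrightarrow>
     (\<exists>\<U>. finite \<U> \<and> (\<forall>U\<in>\<U>. openin Y U) \<and> \<Union>\<U> = topspace Y \<and>
        (\<forall>x\<in>topspace Y. \<forall>y\<in>topspace Y.
           (\<forall>n::nat. \<exists>U\<in>\<U>. (g ^^ n) x \<in> U \<and> (g ^^ n) y \<in> U) \<longrightarrow> x = y))"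

definition solenoid :: "'a topology \<Rightarrow> ('a \<Rightarrow> 'a) \<Rightarrow> (nat \<Rightarrow> 'a) topology" where
  "solenoid Y g =
     subtopology (product_topology (\<lambda>_. Y) UNIV)
       {y. (\<forall>n. y n \<in> topspace Y) \<and> (\<forall>n. g (y (Suc n)) = y n)}"

definition solenoid_map :: "('a \<Rightarrow> 'a) \<Rightarrow> (nat \<Rightarrow> 'a) \<Rightarrow> (nat \<Rightarrow> 'a)" where
  "solenoid_map g y = (\<lambda>n. case n of 0 \<Rightarrow> g (y 0) | Suc m \<Rightarrow> y m)"

definition conjugate :: "'a topology \<Rightarrow> ('a \<Rightarrow> 'a) \<Rightarrow> 'b topology \<Rightarrow> ('b \<Rightarrow> 'b) \<Rightarrow> bool" where
  "conjugate S f T g \<longleftrightarrow>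
     (\<exists>h. homeomorphic_map S T h \<and> (\<forall>x\<in>topspace S. h (f x) = g (h x)))"

end

theory Submission
  imports Defs
begin

text \<open>
  Fix a small \<open>\<delta>\<close>. Local stable sets are compact and totally disconnected, so there is
  \<open>\<eta> > 0\<close> such that every chain of stable steps of length less than \<open>\<eta>\<close> stays within
  distance \<open>\<delta>\<close> of its starting point. Being connected by such a chain is therefore an
  equivalence relation \<open>E\<close> whose classes are compact pieces of local stable sets. It is
  preserved by \<open>\<phi>\<close>, because \<open>\<phi>\<close> contracts stable steps, and saturations of open sets are
  open, because a stable step can be transported to nearby points by the bracket.
  Take \<open>Y = X / E\<close> with the map \<open>g\<close> induced by \<open>\<phi>\<close>. If \<open>\<phi> x\<close> and \<open>\<phi> y\<close> are equivalent and
  \<open>x\<close>, \<open>y\<close> are close, then \<open>x\<close>, \<open>y\<close> differ by a single stable step, so \<open>g\<close> is locally injective.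
  Two points whose forward orbits in \<open>Y\<close> stay close lie on a common local stable set by
  expansiveness of \<open>\<phi>\<close>. The conjugacy sends \<open>x\<close> to the classes of \<open>\<phi>\<^sup>-\<^sup>n x\<close>; it is bijective and
  open because \<open>\<phi>\<^sup>n\<close> shrinks classes uniformly to points.
\<close>

section \<open>Stable sets and chains\<close>

context smale_space
begin

section \<open>The bracket and the homeomorphism on the compact space\<close>

abbreviation \<psi> :: "'a \<Rightarrow> 'a" where "\<psi> \<equiv> inv_into X \<phi>"

text \<open>The pairs at distance at most \<open>\<epsilon>\<close> form a closed subset of the
  compact square of \<open>X\<close>, so the Heine-Cantor theorem applies to the bracket. The later
  closeness estimates for brackets rest on this.\<close>

lemma br_uniform:
  assumes "0 < e"
  obtains \<gamma> where "0 < \<gamma>"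
    "\<And>x y x' y'. \<lbrakk>x \<in> X; y \<in> X; x' \<in> X; y' \<in> X; d x y \<le> \<epsilon>; d x' y' \<le> \<epsilon>; d x x' < \<gamma>; d y y' < \<gamma>\<rbrakk>
       \<Longrightarrow> d (br x y) (br x' y') < e"
proof -
  define m where "m = metric (X, d)"
  define D where "D = {(x, y). x \<in> X \<and> y \<in> X \<and> d x y \<le> \<epsilon>}"
  define md where "md = submetric (prod_metric m m) D"
  have m [simp]: "mspace m = X" "mdist m = d" "mtopology_of m = mtopology"
    unfolding m_def by (auto simp: mtopology_of_def)
  interpret P: Metric_space12 X d X d
    by (simp add: Metric_space12_def Metric_space_axioms)
  have pt: "mtopology_of (prod_metric m m) = prod_topology mtopology mtopology"
    by (simp add: mtopology_of_def P.mtopology_prod_metric)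
  have top: "mtopology_of md = subtopology (prod_topology mtopology mtopology) D"
    unfolding md_def mtopology_of_submetric pt ..
  have D: "D = {p \<in> topspace (prod_topology mtopology mtopology). d (fst p) (snd p) \<in> {..\<epsilon>}}"
    by (auto simp: D_def)
  have "continuous_map (prod_topology mtopology mtopology) euclideanreal (\<lambda>p. d (fst p) (snd p))"
    using continuous_map_metric[of m] by (simp add: case_prod_unfold)
  then have "closedin (prod_topology mtopology mtopology) D"
    unfolding D by (rule closedin_continuous_map_preimage) simp
  moreover have "compact_space (prod_topology mtopology mtopology)"
    using compact by (simp add: compact_space_prod_topology)
  ultimately have "compact_space (mtopology_of md)"
    unfolding top by (simp add: closedin_compact_space compact_space_subtopology)
  then have "uniformly_continuous_map md m (\<lambda>(x, y). br x y)"
    using br_continuous by (intro continuous_imp_uniformly_continuous_map) (simp add: top D_def)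
  then have "\<exists>\<delta>>0. \<forall>p\<in>mspace md. \<forall>q\<in>mspace md. mdist md q p < \<delta> \<longrightarrow>
      mdist m (case q of (x, y) \<Rightarrow> br x y) (case p of (x, y) \<Rightarrow> br x y) < e"
    using assms unfolding uniformly_continuous_map_def by blast
  moreover have "mspace md = D"
    by (auto simp: md_def D_def)
  ultimately obtain \<delta> where \<delta>: "\<delta> > 0"
    and *: "\<forall>p\<in>D. \<forall>q\<in>D. prod_dist d d q p < \<delta> \<longrightarrow> d (case q of (x, y) \<Rightarrow> br x y) (case p of (x, y) \<Rightarrow> br x y) < e"
    by (auto simp: md_def)
  show thesis
  proof
    \<comment> \<open>The product metric is Euclidean, hence at most the sum of the two distances,
      so half of \<open>\<delta>\<close> suffices in each coordinate.\<close>
    show "0 < \<delta> / 2" using \<delta> by simp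
    fix x y x' y'
    assume "x \<in> X" "y \<in> X" "x' \<in> X" "y' \<in> X" "d x y \<le> \<epsilon>" "d x' y' \<le> \<epsilon>" 
      and dd: "d x x' < \<delta> / 2" "d y y' < \<delta> / 2"
    then have "(x, y) \<in> D" "(x', y') \<in> D" by (auto simp: D_def)
    moreover have "prod_dist d d (x, y) (x', y') < \<delta>"
    proof -
      have "prod_dist d d (x, y) (x', y') \<le> d x x' + d y y'"
        by (simp add: prod_dist_def sqrt_sum_squares_le_sum)
      then show ?thesis using dd by simp
    qed
    ultimately show "d (br x y) (br x' y') < e"
      using * by fastforce
  qed
qed

lemma br_in: "\<lbrakk>x \<in> X; y \<in> X; d x y \<le> \<epsilon>\<rbrakk> \<Longrightarrow> br x y \<in> X"
  using Pi_mem[OF continuous_map_funspace[OF br_continuous], of "(x, y)"] by simp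

lemma \<phi>_in [simp]: "x \<in> X \<Longrightarrow> \<phi> x \<in> X"
  using homeomorphic_imp_surjective_map[OF homeo] by auto

lemma \<phi>_surj: "\<phi> ` X = X"
  using homeomorphic_imp_surjective_map[OF homeo] by simp

lemma \<phi>_inj: "inj_on \<phi> X"
  using homeomorphic_imp_injective_map[OF homeo] by simp

lemma \<psi>_in [simp]: "x \<in> X \<Longrightarrow> \<psi> x \<in> X"
  by (metis \<phi>_surj inv_into_into)

lemma \<psi>_\<phi> [simp]: "x \<in> X \<Longrightarrow> \<psi> (\<phi> x) = x"
  using \<phi>_inj by simp

lemma \<phi>_\<psi> [simp]: "x \<in> X \<Longrightarrow> \<phi> (\<psi> x) = x"
  by (simp add: \<phi>_surj f_inv_into_f)

lemma \<phi>_pow_in [simp]: "x \<in> X \<Longrightarrow> (\<phi> ^^ n) x \<in> X"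
  by (induction n) auto

lemma \<psi>_pow_in [simp]: "x \<in> X \<Longrightarrow> (\<psi> ^^ n) x \<in> X"
  by (induction n) auto

lemma \<phi>_pow_\<psi>_pow [simp]: "x \<in> X \<Longrightarrow> (\<phi> ^^ n) ((\<psi> ^^ n) x) = x"
  by (induction n arbitrary: x) (simp_all add: funpow_swap1)

lemma \<psi>_pow_\<phi>_pow [simp]: "x \<in> X \<Longrightarrow> (\<psi> ^^ n) ((\<phi> ^^ n) x) = x"
  by (induction n arbitrary: x) (simp_all add: funpow_swap1)

lemma homeo_inv: "homeomorphic_map mtopology mtopology \<psi>"
proof -
  obtain h where h: "homeomorphic_maps mtopology mtopology \<phi> h"
    using homeo homeomorphic_map_maps by blast
  then have "homeomorphic_map mtopology mtopology h"
    using homeomorphic_maps_map by blast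
  moreover have "h x = \<psi> x" if "x \<in> X" for x
    using h that by (metis \<phi>_\<psi> \<psi>_in homeomorphic_maps_def topspace_mtopology)
  ultimately show ?thesis
    by (auto intro: homeomorphic_map_eq)
qed

lemma continuous_\<phi>: "continuous_map mtopology mtopology \<phi>"
  using homeo by (rule homeomorphic_imp_continuous_map)

lemma continuous_\<psi>: "continuous_map mtopology mtopology \<psi>"
  using homeo_inv by (rule homeomorphic_imp_continuous_map)

section \<open>The stable relation and its contraction\<close>

lemma stable_sym:
  assumes "x \<in> X" "y \<in> X" "d x y \<le> \<epsilon>" "br x y = y"
  shows "br y x = x"
  \<comment> \<open>\<open>[y,x] = [[x,y],x] = [x,x] = x\<close>.\<close>
  using br_left[of x y x] assms eps_pos by (simp add: commute br_idem)

lemma stable_trans: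
  assumes "x \<in> X" "y \<in> X" "z \<in> X" "d x y \<le> \<epsilon>" "d y z \<le> \<epsilon>" "d x z \<le> \<epsilon>"
    and "br x y = y" "br y z = z"
  shows "br x z = z"
  using br_left[of x y z] assms by simp

text \<open>Contraction keeps the images within \<open>\<epsilon>\<close> of each other, which makes
  the equivariance of the bracket applicable; so the relation passes to forward images.\<close>

lemma stable_\<phi>:
  assumes "x \<in> X" "y \<in> X" "d x y \<le> \<epsilon>" "br x y = y"
  shows "d (\<phi> x) (\<phi> y) \<le> lam * d x y" "d (\<phi> x) (\<phi> y) \<le> d x y" "br (\<phi> x) (\<phi> y) = \<phi> y"
proof -
  show *: "d (\<phi> x) (\<phi> y) \<le> lam * d x y"
    using contract assms by blast
  also have "\<dots> \<le> 1 * d x y"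
    using lam_less_1 by (intro mult_right_mono) auto
  finally show **: "d (\<phi> x) (\<phi> y) \<le> d x y" by simp
  show "br (\<phi> x) (\<phi> y) = \<phi> y"
    using br_equivariant[of x y] ** assms by simp
qed

lemma stable_\<phi>_pow:
  assumes "x \<in> X" "y \<in> X" "d x y \<le> \<epsilon>" "br x y = y"
  shows "d ((\<phi> ^^ n) x) ((\<phi> ^^ n) y) \<le> lam ^ n * d x y \<and> 
         d ((\<phi> ^^ n) x) ((\<phi> ^^ n) y) \<le> \<epsilon> \<and> br ((\<phi> ^^ n) x) ((\<phi> ^^ n) y) = (\<phi> ^^ n) y"
proof (induction n)
  case (Suc n)
  let ?u = "(\<phi> ^^ n) x" and ?v = "(\<phi> ^^ n) y"
  have uv: "?u \<in> X" "?v \<in> X" "d ?u ?v \<le> \<epsilon>" "br ?u ?v = ?v"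
    using Suc assms by simp_all
  have "d (\<phi> ?u) (\<phi> ?v) \<le> lam * d ?u ?v"
    using stable_\<phi>(1)[OF uv] .
  also have "\<dots> \<le> lam * (lam ^ n * d x y)"
    using Suc lam_pos by (intro mult_left_mono) auto
  finally have "d (\<phi> ?u) (\<phi> ?v) \<le> lam ^ Suc n * d x y"
    by (simp add: mult.assoc)
  moreover have "d (\<phi> ?u) (\<phi> ?v) \<le> \<epsilon>"
    using stable_\<phi>(2)[OF uv] uv(3) by linarith
  ultimately show ?case
    using stable_\<phi>(3)[OF uv] by simp
qed (use assms in auto)

lemma stable_set_if_stable:
  assumes "x \<in> X" "y \<in> X" "d x y \<le> \<epsilon>" "br x y = y"
  shows "y \<in> stable_set x"
proof -
  have *: "(\<lambda>n. lam ^ n * d x y) \<longlonglongrightarrow> 0"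
    using lam_pos lam_less_1 by (intro tendsto_mult_left_zero LIMSEQ_power_zero) auto
  have "(\<lambda>n. d ((\<phi> ^^ n) x) ((\<phi> ^^ n) y)) \<longlonglongrightarrow> 0"
    by (rule Lim_null_comparison[OF _ *]) (simp add: stable_\<phi>_pow[OF assms])
  then show ?thesis
    using assms by (simp add: stable_set_def)
qed

lemma stable_set_trans: 
  assumes "x \<in> X" "y \<in> stable_set x" "z \<in> stable_set y"
  shows "z \<in> stable_set x"
proof -
  have X: "y \<in> X" "z \<in> X" using assms by (auto simp: stable_set_def)
  have *: "(\<lambda>n. d ((\<phi> ^^ n) x) ((\<phi> ^^ n) y) + d ((\<phi> ^^ n) y) ((\<phi> ^^ n) z)) \<longlonglongrightarrow> 0"
    using assms by (intro tendsto_add_zero) (auto simp: stable_set_def)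
  have "(\<lambda>n. d ((\<phi> ^^ n) x) ((\<phi> ^^ n) z)) \<longlonglongrightarrow> 0"
    by (rule Lim_null_comparison[OF _ *]) (simp add: triangle assms(1) X)
  then show ?thesis using X by (simp add: stable_set_def)
qed

text \<open>The carrier is the largest \<open>stable_open\<close> set, so the whole stable set has
  to be open. It is, since a point stably related to \<open>y\<close> is asymptotic to
  \<open>y\<close> and asymptoticity is transitive.\<close>

lemma topspace_stable_topology:
  assumes "x \<in> X"
  shows "topspace (stable_topology x) = stable_set x"
proof -
  have "stable_open x (stable_set x)"
    unfolding stable_open_def
  proof (intro conjI ballI)
    fix y assume y: "y \<in> stable_set x"
    have "local_stable_set y \<epsilon> \<subseteq> stable_set x"
    proof
      fix z assume "z \<in> local_stable_set y \<epsilon>"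
      then have "z \<in> stable_set y"
        using y by (intro stable_set_if_stable) (auto simp: local_stable_set_def stable_set_def)
      then show "z \<in> stable_set x" using stable_set_trans assms y by blast
    qed
    then show "\<exists>\<delta>>0. \<delta> \<le> \<epsilon> \<and> local_stable_set y \<delta> \<subseteq> stable_set x"
      using eps_pos by blast
  qed simp
  then show ?thesis
    unfolding topspace_def by (auto simp: stable_open_def)
qed

section \<open>Closed local stable sets as compact, totally disconnected spaces\<close>

definition closed_local_stable_set :: "'a \<Rightarrow> real \<Rightarrow> 'a set" where
  "closed_local_stable_set x r = {z \<in> X. d x z \<le> r \<and> br x z = z}"

text \<open>On the closed ball of radius \<open>\<epsilon>\<close> the map \<open>br x\<close> is
  continuous; the set where it agrees with the identity is closed because \<open>X\<close> is
  Hausdorff.\<close>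

lemma closedin_closed_local_stable_set:
  assumes "x \<in> X" "r \<le> \<epsilon>"
  shows "closedin mtopology (closed_local_stable_set x r)"
proof -
  let ?T = "subtopology mtopology (mcball x \<epsilon>)"
  have 1: "continuous_map ?T (subtopology (prod_topology mtopology mtopology) {(x, y). x \<in> X \<and> y \<in> X \<and> d x y \<le> \<epsilon>}) (\<lambda>z. (x, z))"
    using assms by (auto simp: continuous_map_in_subtopology continuous_map_pairwise o_def)
  have "continuous_map ?T mtopology (br x)"
    using continuous_map_compose[OF 1 br_continuous] by (simp add: o_def)
  then have "closedin ?T {z \<in> topspace ?T. br x z = z}"
    by (intro closedin_continuous_maps_eq[OF Hausdorff_space_mtopology]) auto
  then have "closedin mtopology {z \<in> topspace ?T. br x z = z}"
    using closedin_mcball closedin_trans_full by blast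
  then have "closedin mtopology ({z \<in> topspace ?T. br x z = z} \<inter> mcball x r)"
    by (intro closedin_Int) auto
  moreover have "{z \<in> topspace ?T. br x z = z} \<inter> mcball x r = closed_local_stable_set x r"
    using assms by (auto simp: closed_local_stable_set_def)
  ultimately show ?thesis by simp
qed

lemma stable_within_closed_local_stable_set:
  assumes "x \<in> X" "2 * r \<le> \<epsilon>" "y \<in> closed_local_stable_set x r" "z \<in> closed_local_stable_set x r"
  shows "d y z \<le> \<epsilon>" "br y z = z"
proof -
  have *: "y \<in> X" "z \<in> X" "d x y \<le> r" "d x z \<le> r" "br x y = y" "br x z = z"
    using assms by (auto simp: closed_local_stable_set_def)
  have r: "r \<le> \<epsilon>"
    using assms eps_pos by linarith
  show d: "d y z \<le> \<epsilon>"
    using triangle[of y x z] assms * by (simp add: commute)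
  show "br y z = z"
  proof (rule stable_trans[of y x z])
    show "br y x = x" using stable_sym[of x y] * r assms(1) by simp
    show "d y x \<le> \<epsilon>" using * r by (simp add: commute)
  qed (use assms(1) * r d in auto)
qed

text \<open>Inside such a set any two points are stably related, so a metric ball around
  \<open>y\<close> meets it only in points of a local stable set of \<open>y\<close>. Hence the
  identity is continuous from the metric to the stable topology, and total disconnectedness can be
  used in the metric topology.\<close>

lemma connectedin_stable_topology:
  assumes x: "x \<in> X" and r: "2 * r \<le> \<epsilon>" and S: "connectedin mtopology S" "S \<subseteq> closed_local_stable_set x r"
  shows "connectedin (stable_topology x) S"
proof -
  have "continuous_map (subtopology mtopology (closed_local_stable_set x r)) (stable_topology x) id"
    unfolding continuous_map_def
  proof (intro conjI allI impI)
    show "id \<in> topspace (subtopology mtopology (closed_local_stable_set x r)) \<rightarrow> topspace (stable_topology x)"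
      using x r eps_pos by (auto simp: topspace_stable_topology closed_local_stable_set_def intro!: stable_set_if_stable)
    fix U assume "openin (stable_topology x) U"
    then have U: "stable_open x U" by simp
    show "openin (subtopology mtopology (closed_local_stable_set x r)) {y \<in> topspace (subtopology mtopology (closed_local_stable_set x r)). id y \<in> U}"
      (is "openin _ ?W")
    proof (subst openin_subopen, intro ballI)
      fix y assume "y \<in> ?W"
      then have y: "y \<in> X" "y \<in> closed_local_stable_set x r" "y \<in> U" by auto
      then obtain \<delta> where \<delta>: "\<delta> > 0" "\<delta> \<le> \<epsilon>" "local_stable_set y \<delta> \<subseteq> U"
        using U by (auto simp: stable_open_def)
      have "closed_local_stable_set x r \<inter> mball y \<delta> \<subseteq> ?W"
        using stable_within_closed_local_stable_set[OF x r y(2)] \<delta>(3) by (auto simp: local_stable_set_def)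
      moreover have "openin (subtopology mtopology (closed_local_stable_set x r)) (closed_local_stable_set x r \<inter> mball y \<delta>)"
        by (simp add: openin_subtopology_Int2)
      ultimately show "\<exists>T. openin (subtopology mtopology (closed_local_stable_set x r)) T \<and> y \<in> T \<and> T \<subseteq> ?W"
        using y \<delta> by (intro exI[of _ "closed_local_stable_set x r \<inter> mball y \<delta>"]) auto
    qed
  qed
  moreover have "connectedin (subtopology mtopology (closed_local_stable_set x r)) S"
    using S by (simp add: connectedin_subtopology)
  ultimately have "connectedin (stable_topology x) (id ` S)"
    by (rule connectedin_continuous_map_image)
  then show ?thesis by simp
qed

text \<open>In a compact Hausdorff space, closed sets that no connected set joins are separated by a
  clopen partition. Here connected sets are at most singletons, so \<open>x\<close> is cut off from
  everything outside the ball.\<close>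

lemma closed_local_stable_set_separation:
  assumes x: "x \<in> X" and r: "2 * r \<le> \<epsilon>" "0 \<le> r" and "0 < e"
    and td: "totally_disconnected_space (stable_topology x)"
  obtains A B \<rho> where "A \<union> B = closed_local_stable_set x r" "x \<in> A" "A \<subseteq> mball x e" "0 < \<rho>"
    "\<And>a b. \<lbrakk>a \<in> A; b \<in> B\<rbrakk> \<Longrightarrow> \<rho> \<le> d a b"
proof -
  let ?T = "subtopology mtopology (closed_local_stable_set x r)"
  have KX: "closed_local_stable_set x r \<subseteq> X" by (auto simp: closed_local_stable_set_def)
  then have top: "topspace ?T = closed_local_stable_set x r" by auto
  have "x \<in> closed_local_stable_set x r"
    using x r by (simp add: closed_local_stable_set_def br_idem)
  have clo: "closedin mtopology (closed_local_stable_set x r)"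
    using x r eps_pos by (intro closedin_closed_local_stable_set) auto
  then have comp: "compactin mtopology (closed_local_stable_set x r)"
    using compact closedin_compact_space by blast
  have "separated_between ?T {x} (closed_local_stable_set x r - mball x e)"
  proof (rule cut_wire_fence_theorem)
    show "compact_space ?T"
      using comp compact_space_subtopology by blast
    show "Hausdorff_space ?T"
      by (simp add: Hausdorff_space_mtopology Hausdorff_space_subtopology)
    then show "closedin ?T {x}"
      using \<open>x \<in> closed_local_stable_set x r\<close> top by (simp add: closedin_Hausdorff_sing_eq)
    show "closedin ?T (closed_local_stable_set x r - mball x e)"
      using clo by (simp add: closedin_closed_subtopology closedin_diff)
    fix C assume "connectedin ?T C"
    then have "connectedin mtopology C" "C \<subseteq> closed_local_stable_set x r"
      by (simp_all add: connectedin_subtopology)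
    then have "connectedin (stable_topology x) C"
      using connectedin_stable_topology[OF x r(1)] by blast
    then have C: "u = v" if "u \<in> C" "v \<in> C" for u v
      using td that unfolding totally_disconnected_space_def by blast
    show "disjnt C {x} \<or> disjnt C (closed_local_stable_set x r - mball x e)"
    proof (cases "x \<in> C")
      case True
      then have "C \<subseteq> mball x e"
        using C[of x] \<open>0 < e\<close> x by (metis centre_in_mball_iff subsetI)
      then show ?thesis
        unfolding disjnt_def by blast
    qed (simp add: disjnt_def)
  qed
  then obtain A B where AB: "openin ?T A" "openin ?T B" "A \<union> B = closed_local_stable_set x r" "disjnt A B" "{x} \<subseteq> A" "closed_local_stable_set x r - mball x e \<subseteq> B"
    unfolding separated_between_def top by blast
  then obtain A' B' where A': "openin mtopology A'" "A = A' \<inter> closed_local_stable_set x r" and B': "openin mtopology B'" "B = B' \<inter> closed_local_stable_set x r"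
    unfolding openin_subtopology by blast
  \<comment> \<open>A Lebesgue number of the cover by \<open>A'\<close> and \<open>B'\<close> turns
    the partition into one with a positive gap.\<close>
  have "\<exists>\<rho>>0. \<forall>a\<in>closed_local_stable_set x r. \<exists>U\<in>{A', B'}. mball a \<rho> \<subseteq> U"
    using comp by (rule lebesgue_number) (use A' B' AB(3) in blast)+
  then obtain \<rho> where \<rho>: "\<rho> > 0" "\<And>a. a \<in> closed_local_stable_set x r \<Longrightarrow> mball a \<rho> \<subseteq> A' \<or> mball a \<rho> \<subseteq> B'"
    by blast
  show thesis
  proof
    show "A \<union> B = closed_local_stable_set x r" "0 < \<rho>" by fact+
    show "x \<in> A" using AB(5) by simp
    show "A \<subseteq> mball x e" using AB(3,4,6) unfolding disjnt_def by blast
    fix a b assume ab: "a \<in> A" "b \<in> B"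
    show "\<rho> \<le> d a b"
    proof (rule ccontr)
      assume "\<not> \<rho> \<le> d a b"
      then have "a \<in> mball a \<rho>" "b \<in> mball a \<rho>"
        using ab AB(3) KX \<rho>(1) by auto
      moreover have "a \<in> closed_local_stable_set x r" "b \<in> closed_local_stable_set x r" using ab AB(3) by auto
      ultimately have "a \<in> A' \<and> b \<in> A' \<or> a \<in> B' \<and> b \<in> B'"
        using \<rho>(2)[of a] by blast
      then show False
        using ab A'(2) B'(2) AB(3,4) unfolding disjnt_def by blast
    qed
  qed
qed

section \<open>Chains of stable steps\<close>

definition stable_step :: "real \<Rightarrow> ('a \<times> 'a) set" where
  "stable_step \<eta> = {(x, y). x \<in> X \<and> y \<in> X \<and> d x y < \<eta> \<and> br x y = y}"

text \<open>
  A chain starting near \<open>x\<close> is projected to the local stable set of \<open>x\<close> by the bracket; the projected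
  chain cannot leave a small piece that is separated from the rest of that set.
\<close>

lemma stable_chain_bounded_near:
  assumes x: "x \<in> X" and "0 < \<delta>"
    and td: "totally_disconnected_space (stable_topology x)"
  shows "\<exists>\<tau>>0. \<forall>x'\<in>mball x \<tau>. \<forall>c. (x', c) \<in> (stable_step \<tau>)\<^sup>* \<longrightarrow> d x' c < \<delta> \<and> br x' c = c"
proof -
  have "0 < \<epsilon> / 2" using eps_pos by simp
  then obtain s where s: "0 < s" "\<And>x y x' y'. \<lbrakk>x \<in> X; y \<in> X; x' \<in> X; y' \<in> X; d x y \<le> \<epsilon>; d x' y' \<le> \<epsilon>; d x x' < s; d y y' < s\<rbrakk>
       \<Longrightarrow> d (br x y) (br x' y') < \<epsilon> / 2"
    using br_uniform by blast
  \<comment> \<open>\<open>s / 2\<close> keeps the projection \<open>br x c\<close> within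
    \<open>\<epsilon> / 2\<close> of \<open>x\<close> for every \<open>c\<close> closer than
    \<open>2 * \<delta>'\<close>; \<open>\<epsilon> / 2\<close> keeps such \<open>c\<close> in the
    domain of the bracket.\<close>
  define \<delta>' where "\<delta>' = min \<delta> (min (s / 2) (\<epsilon> / 2))"
  have \<delta>': "0 < \<delta>'" "\<delta>' \<le> \<delta>" "2 * \<delta>' \<le> s" "2 * \<delta>' \<le> \<epsilon>"
    using s(1) assms(2) eps_pos by (auto simp: \<delta>'_def)
  have "2 * (\<epsilon> / 2) \<le> \<epsilon>" "0 \<le> \<epsilon> / 2" "0 < \<delta>' / 3" using eps_pos \<delta>'(1) by auto
  then obtain A B \<rho> where AB: "A \<union> B = closed_local_stable_set x (\<epsilon> / 2)" "x \<in> A" "A \<subseteq> mball x (\<delta>' / 3)" "0 < \<rho>"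
    "\<And>a b. \<lbrakk>a \<in> A; b \<in> B\<rbrakk> \<Longrightarrow> \<rho> \<le> d a b"
    using closed_local_stable_set_separation[OF x _ _ _ td] by blast
  have "0 < min \<rho> (\<delta>' / 3)" using AB(4) \<delta>'(1) by simp
  then obtain \<gamma> where \<gamma>: "0 < \<gamma>" "\<And>x y x' y'. \<lbrakk>x \<in> X; y \<in> X; x' \<in> X; y' \<in> X; d x y \<le> \<epsilon>; d x' y' \<le> \<epsilon>; d x x' < \<gamma>; d y y' < \<gamma>\<rbrakk>
       \<Longrightarrow> d (br x y) (br x' y') < min \<rho> (\<delta>' / 3)"
    using br_uniform by blast
  \<comment> \<open>A step shorter than \<open>\<gamma>\<close> moves the projection by less than
    the gap \<open>\<rho>\<close>, too little to pass from \<open>A\<close> to \<open>B\<close>;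
    \<open>\<delta>' / 3\<close> leaves room for the three terms of the final triangle
    inequality.\<close>
  define \<tau> where "\<tau> = min \<gamma> (\<delta>' / 3)"
  have \<tau>: "0 < \<tau>" "\<tau> \<le> \<gamma>" "3 * \<tau> \<le> \<delta>'"
    using \<gamma>(1) \<delta>'(1) by (auto simp: \<tau>_def)
  have br_close: "br x c \<in> closed_local_stable_set x (\<epsilon> / 2)" if c: "c \<in> X" "d x c < 2 * \<delta>'" for c
  proof -
    have dc: "d x c \<le> \<epsilon>" using c \<delta>' by linarith
    have "d (br x x) (br x c) < \<epsilon> / 2"
      by (rule s(2)) (use x c \<delta>' s(1) dc eps_pos in auto)
    then have dx: "d x (br x c) < \<epsilon> / 2" by (simp only: br_idem x)
    have "br x (br x c) = br x c"
      by (rule br_right) (use dx x c dc eps_pos in auto)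
    then show ?thesis using br_in[OF x c(1) dc] dx by (simp add: closed_local_stable_set_def)
  qed
  have nextA: "br x c' \<in> A" if c: "c \<in> X" "c' \<in> X" "br x c \<in> A" "d c c' < \<tau>" "d x c < 2 * \<delta>'" "d x c' < 2 * \<delta>'" for c c'
  proof -
    have "d (br x c) (br x c') < min \<rho> (\<delta>' / 3)"
      by (rule \<gamma>(2)) (use c x \<tau> \<gamma>(1) \<delta>' in auto)
    then have "br x c' \<notin> B" using AB(5)[OF c(3), of "br x c'"] by linarith
    then show ?thesis using br_close[OF c(2,6)] AB(1) by blast
  qed
  \<comment> \<open>The projection staying in \<open>A\<close> is the invariant that prevents drift;
    a distance bound alone would deteriorate with every step.\<close>
  have main: "c \<in> X \<and> d x' c < \<delta>' \<and> br x' c = c \<and> br x c \<in> A"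
    if x': "x' \<in> mball x \<tau>" and "(x', c) \<in> (stable_step \<tau>)\<^sup>*" for x' c
    using that(2)
  proof (induction rule: rtrancl_induct)
    case base
    have X: "x' \<in> X" "d x x' < \<tau>" using x' by auto
    have "br x x' \<in> A"
    proof (rule nextA)
      show "br x x \<in> A" using AB(2) x by (simp only: br_idem)
    qed (use x X \<tau> \<delta>' in auto)
    then show ?case using X \<delta>'(1) by (simp add: br_idem)
  next
    case (step c c')
    have X: "x' \<in> X" "d x x' < \<tau>" "c \<in> X" "c' \<in> X" "d c c' < \<tau>" "br c c' = c'"
      using step.hyps x' by (auto simp: stable_step_def)
    have IH: "d x' c < \<delta>'" "br x' c = c" "br x c \<in> A"
      using step.IH by blast+
    \<comment> \<open>These weak bounds suffice to define the brackets and control the projections;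
      the bound on \<open>d x' c'\<close> is restored to \<open>\<delta>'\<close> at the end of the
      step.\<close>
    have dx'c': "d x' c' < 2 * \<delta>'"
      using triangle[OF X(1,3,4)] X(5) IH(1) \<tau> by linarith
    have dxc: "d x c < 2 * \<delta>'"
      using triangle[OF x X(1,3)] X(2) IH(1) \<tau> by linarith
    have dxc': "d x c' < 2 * \<delta>'"
      using triangle[OF x X(1,3)] triangle[OF x X(3,4)] X(2,5) IH(1) \<tau> by linarith
    have st: "br x' c' = c'"
      by (rule stable_trans[of x' c c']) (use X IH dx'c' \<delta>' \<tau> in auto)
    have A: "br x c' \<in> A"
      by (rule nextA[OF X(3,4) IH(3) X(5) dxc dxc'])
    then have dA: "br x c' \<in> X" "d x (br x c') < \<delta>' / 3"
      using AB(3) by auto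
    have "d x' (br x c') \<le> d x x' + d x (br x c')"
      using triangle[OF X(1) x dA(1)] by (simp only: commute[of x x'])
    then have d3: "d x' (br x c') \<le> \<epsilon>"
      using X(2) dA(2) \<tau> \<delta>' by linarith
    \<comment> \<open>This bracket equals \<open>c'\<close>, whereas \<open>br x (br x c')\<close>
      is the projection itself. As \<open>x\<close> and \<open>x'\<close> are close,
      \<open>c'\<close> is close to its projection, which lies in \<open>A\<close> and so near
      \<open>x\<close>.\<close>
    have "br x' (br x c') = br x' c'"
      by (rule br_right) (use X(1,4) x dx'c' dxc' d3 \<delta>' in auto)
    moreover have "br x (br x c') = br x c'"
      using br_close[OF X(4) dxc'] by (simp add: closed_local_stable_set_def)
    moreover have "d (br x (br x c')) (br x' (br x c')) < min \<rho> (\<delta>' / 3)"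
      by (rule \<gamma>(2)) (use X(1,2) x dA d3 \<tau> \<gamma>(1) \<delta>' in auto)
    ultimately have "d (br x c') c' < \<delta>' / 3" using st by simp
    moreover have "d x' c' \<le> d x' (br x c') + d (br x c') c'"
      by (rule triangle[OF X(1) dA(1) X(4)])
    ultimately have "d x' c' < \<delta>'"
      using \<open>d x' (br x c') \<le> d x x' + d x (br x c')\<close> X(2) dA(2) \<tau> by linarith
    then show ?case using X(4) st A by blast
  qed
  show ?thesis
  proof (intro exI[of _ \<tau>] conjI ballI allI impI)
    show "0 < \<tau>" by fact
    fix x' c assume "x' \<in> mball x \<tau>" "(x', c) \<in> (stable_step \<tau>)\<^sup>*"
    from main[OF this] show "d x' c < \<delta>" "br x' c = c" using \<delta>'(2) by auto
  qed
qed

lemma stable_step_mono: "\<eta> \<le> \<eta>' \<Longrightarrow> stable_step \<eta> \<subseteq> stable_step \<eta>'"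
  by (auto simp: stable_step_def)

text \<open>Compactness makes the local bound uniform: finitely many of the balls cover
  \<open>X\<close>, and shortening the steps to the least of their radii only removes
  chains.\<close>

lemma stable_chain_bounded:
  assumes td: "\<forall>x\<in>X. totally_disconnected_space (stable_topology x)" and "0 < \<delta>"
  obtains \<eta> where "0 < \<eta>" "\<eta> \<le> \<delta>"
    "\<And>x c. \<lbrakk>x \<in> X; (x, c) \<in> (stable_step \<eta>)\<^sup>*\<rbrakk> \<Longrightarrow> d x c < \<delta> \<and> br x c = c"
proof -
  have "\<forall>x\<in>X. \<exists>\<tau>. 0 < \<tau> \<and>
    (\<forall>x'\<in>mball x \<tau>. \<forall>c. (x', c) \<in> (stable_step \<tau>)\<^sup>* \<longrightarrow> d x' c < \<delta> \<and> br x' c = c)"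
    using stable_chain_bounded_near[OF _ \<open>0 < \<delta>\<close>] td by blast
  then obtain \<tau> where \<tau>: "\<forall>x\<in>X. 0 < \<tau> x \<and>
    (\<forall>x'\<in>mball x (\<tau> x). \<forall>c. (x', c) \<in> (stable_step (\<tau> x))\<^sup>* \<longrightarrow> d x' c < \<delta> \<and> br x' c = c)"
    by (rule bchoice[THEN exE])
  have "compactin mtopology X"
    using compact by (simp add: compact_space_def)
  moreover have "X \<subseteq> \<Union>((\<lambda>x. mball x (\<tau> x)) ` X)"
  proof
    fix x assume "x \<in> X"
    then show "x \<in> \<Union>((\<lambda>x. mball x (\<tau> x)) ` X)"
      using \<tau> by (intro UN_I[of x]) auto
  qed
  ultimately obtain \<F> where \<F>: "finite \<F>" "\<F> \<subseteq> (\<lambda>x. mball x (\<tau> x)) ` X" "X \<subseteq> \<Union>\<F>"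
    by (elim compactinD[THEN exE]) auto
  obtain F where F: "F \<subseteq> X" "finite F" "\<F> = (\<lambda>x. mball x (\<tau> x)) ` F"
    using finite_subset_image[OF \<F>(1,2)] by blast
  \<comment> \<open>Inserting \<open>\<delta>\<close> gives \<open>\<eta> \<le> \<delta>\<close> and
    keeps the minimum meaningful when \<open>F\<close> is empty.\<close>
  define \<eta> where "\<eta> = Min (insert \<delta> (\<tau> ` F))"
  show thesis
  proof
    show "0 < \<eta>"
      unfolding \<eta>_def using F(1,2) \<tau> \<open>0 < \<delta>\<close> by (subst Min_gr_iff) auto
    show "\<eta> \<le> \<delta>"
      unfolding \<eta>_def using F(2) by (intro Min_le) auto
    fix x c assume "x \<in> X" and c: "(x, c) \<in> (stable_step \<eta>)\<^sup>*"
    then obtain y where y: "y \<in> F" "x \<in> mball y (\<tau> y)" using F(3) \<F>(3) by blast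
    have "\<eta> \<le> \<tau> y"
      unfolding \<eta>_def using F(2) y(1) by (intro Min_le) auto
    then have "(x, c) \<in> (stable_step (\<tau> y))\<^sup>*"
      using c rtrancl_mono[OF stable_step_mono] by blast
    then show "d x c < \<delta> \<and> br x c = c"
      using \<tau> y F(1) by blast
  qed
qed

section \<open>Forward expansiveness\<close>

lemma unstable_\<psi>:
  assumes "x \<in> X" "y \<in> X" "d x y \<le> \<epsilon>" "br x y = x"
  shows "d (\<psi> x) (\<psi> y) \<le> lam * d x y"
  using contract_inv assms by blast

text \<open>The bracket of the two orbits at time \<open>n\<close> is unstably related to the second
  orbit and within \<open>\<epsilon>\<close> of it. Pulling back contracts, so at time 0 the
  distance is at most \<open>lam ^ n * \<epsilon>\<close> for all \<open>n\<close>, and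
  \<open>br x y = y\<close>. The factor 3 anticipates orbits compared through two chain classes and
  one short gap.\<close>

lemma forward_expansive:
  obtains \<delta> where "0 < \<delta>" "4 * \<delta> \<le> \<epsilon>"
    "\<And>x y. \<lbrakk>x \<in> X; y \<in> X; \<And>n. d ((\<phi> ^^ n) x) ((\<phi> ^^ n) y) \<le> 3 * \<delta>\<rbrakk> \<Longrightarrow> br x y = y"
proof -
  obtain \<gamma> where \<gamma>: "0 < \<gamma>" "\<And>x y x' y'. \<lbrakk>x \<in> X; y \<in> X; x' \<in> X; y' \<in> X; d x y \<le> \<epsilon>; d x' y' \<le> \<epsilon>; d x x' < \<gamma>; d y y' < \<gamma>\<rbrakk>
       \<Longrightarrow> d (br x y) (br x' y') < \<epsilon>"
    using br_uniform[OF eps_pos] by blast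
  define \<delta> where "\<delta> = min (\<epsilon> / 4) (\<gamma> / 4)"
  have \<delta>: "0 < \<delta>" "4 * \<delta> \<le> \<epsilon>" "3 * \<delta> < \<gamma>"
    using \<gamma>(1) eps_pos by (auto simp: \<delta>_def)
  have "br x y = y" if x: "x \<in> X" and y: "y \<in> X" and close: "\<And>n. d ((\<phi> ^^ n) x) ((\<phi> ^^ n) y) \<le> 3 * \<delta>" for x y
  proof -
    define v where "v n = br ((\<phi> ^^ n) x) ((\<phi> ^^ n) y)" for n
    have le: "d ((\<phi> ^^ n) x) ((\<phi> ^^ n) y) \<le> \<epsilon>" for n
      using close[of n] \<delta> by linarith
    have v: "v n \<in> X" for n
      unfolding v_def using br_in[OF _ _ le] x y by simp
    have dv: "d (v n) ((\<phi> ^^ n) y) \<le> \<epsilon>" for n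
    proof -
      have "d (br ((\<phi> ^^ n) x) ((\<phi> ^^ n) y)) (br ((\<phi> ^^ n) y) ((\<phi> ^^ n) y)) < \<epsilon>"
        by (rule \<gamma>(2)) (use x y le[of n] close[of n] \<delta> \<gamma>(1) eps_pos in auto)
      then show ?thesis by (simp add: br_idem y v_def)
    qed
    have u: "br (v n) ((\<phi> ^^ n) y) = v n" for n
      using br_left[OF _ _ _ le dv[unfolded v_def] le] x y by (simp add: v_def)
    have "d (\<psi> (v (Suc n))) (\<psi> ((\<phi> ^^ Suc n) y)) \<le> lam * d (v (Suc n)) ((\<phi> ^^ Suc n) y)" for n
      using y by (intro unstable_\<psi> v dv u \<phi>_pow_in)
    moreover have "\<psi> (v (Suc n)) = v n" for n
    proof -
      have "\<phi> (v n) = v (Suc n)"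
        unfolding v_def using br_equivariant[OF _ _ le[of n]] le[of "Suc n"] x y by simp
      then show ?thesis using \<psi>_\<phi>[OF v[of n]] by simp
    qed
    moreover have "\<psi> ((\<phi> ^^ Suc n) y) = (\<phi> ^^ n) y" for n
      using y by simp
    ultimately have step: "d (v n) ((\<phi> ^^ n) y) \<le> lam * d (v (Suc n)) ((\<phi> ^^ Suc n) y)" for n
      by metis
    have bound: "d (v 0) y \<le> lam ^ n * d (v n) ((\<phi> ^^ n) y)" for n
    proof (induction n)
      case (Suc n)
      also have "lam ^ n * d (v n) ((\<phi> ^^ n) y) \<le> lam ^ n * (lam * d (v (Suc n)) ((\<phi> ^^ Suc n) y))"
        using step[of n] lam_pos by (intro mult_left_mono) auto
      finally show ?case by (simp only: power_Suc2 mult.assoc)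
    qed simp
    have "d (v 0) y \<le> lam ^ n * \<epsilon>" for n
    proof -
      note bound[of n]
      also have "lam ^ n * d (v n) ((\<phi> ^^ n) y) \<le> lam ^ n * \<epsilon>"
        using dv[of n] lam_pos by (intro mult_left_mono) auto
      finally show ?thesis .
    qed
    moreover have "(\<lambda>n. lam ^ n * \<epsilon>) \<longlonglongrightarrow> 0"
      using lam_pos lam_less_1 by (intro tendsto_mult_left_zero LIMSEQ_power_zero) auto
    ultimately have "d (v 0) y \<le> 0"
      by (intro LIMSEQ_le_const) auto
    then have "d (v 0) y = 0"
      using nonneg[of "v 0" y] by linarith
    then show ?thesis using v[of 0] y by (simp add: v_def)
  qed
  then show thesis using \<delta> that by blast
qed

end

section \<open>Quotient topologies and local homeomorphisms\<close>

text \<open>For a set \<open>V\<close> of classes, \<open>\<Union>V\<close> is its preimage under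
  the projection, so this is the usual quotient topology.\<close>

definition quotient_topology :: "'a topology \<Rightarrow> ('a \<times> 'a) set \<Rightarrow> 'a set topology" where
  "quotient_topology T E = topology (\<lambda>V. V \<subseteq> topspace T // E \<and> openin T (\<Union>V))"

context
  fixes T :: "'a topology" and E :: "('a \<times> 'a) set"
  assumes E: "equiv (topspace T) E"
begin

lemma openin_quotient_topology:
  "openin (quotient_topology T E) V \<longleftrightarrow> V \<subseteq> topspace T // E \<and> openin T (\<Union>V)"
proof -
  have "istopology (\<lambda>V. V \<subseteq> topspace T // E \<and> openin T (\<Union>V))"
    unfolding istopology_def
  proof (intro conjI allI impI)
    fix S S' assume S: "S \<subseteq> topspace T // E \<and> openin T (\<Union>S)" and S': "S' \<subseteq> topspace T // E \<and> openin T (\<Union>S')"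
    \<comment> \<open>Distinct classes are disjoint, so here the union commutes with the
      intersection.\<close>
    then have "\<Union>(S \<inter> S') = \<Union>S \<inter> \<Union>S'"
      using quotient_disj[OF E] by blast
    then show "openin T (\<Union>(S \<inter> S'))" using S S' by auto
    show "S \<inter> S' \<subseteq> topspace T // E" using S by auto
  next
    fix \<K> assume *: "\<forall>K\<in>\<K>. K \<subseteq> topspace T // E \<and> openin T (\<Union>K)"
    then show "\<Union>\<K> \<subseteq> topspace T // E" by auto
    have "\<Union>(\<Union>\<K>) = \<Union>(Union ` \<K>)" by auto
    then show "openin T (\<Union>(\<Union>\<K>))" using * by auto
  qed
  then show ?thesis
    unfolding quotient_topology_def by (simp add: topology_inverse')
qed

lemma topspace_quotient_topology: "topspace (quotient_topology T E) = topspace T // E"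
proof -
  have "openin (quotient_topology T E) (topspace T // E)"
    using Union_quotient[OF E] by (simp add: openin_quotient_topology)
  then show ?thesis
    using openin_quotient_topology openin_subset openin_topspace by blast
qed

lemma continuous_map_quotient_topology: "continuous_map T (quotient_topology T E) (\<lambda>x. E `` {x})"
  unfolding continuous_map_def
proof (intro conjI allI impI)
  show "(\<lambda>x. E `` {x}) \<in> topspace T \<rightarrow> topspace (quotient_topology T E)"
    by (auto simp: topspace_quotient_topology quotientI)
  fix V assume "openin (quotient_topology T E) V"
  then have V: "V \<subseteq> topspace T // E" "openin T (\<Union>V)"
    by (simp_all add: openin_quotient_topology)
  have "{x \<in> topspace T. E `` {x} \<in> V} = \<Union>V"
  proof
    show "{x \<in> topspace T. E `` {x} \<in> V} \<subseteq> \<Union>V"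
      using equiv_class_self[OF E] by blast
    show "\<Union>V \<subseteq> {x \<in> topspace T. E `` {x} \<in> V}"
    proof clarify
      fix x A assume xA: "x \<in> A" "A \<in> V"
      then obtain a where "A = E `` {a}" "a \<in> topspace T"
        using V(1) by (meson quotientE subsetD)
      then have "A = E `` {x}"
        using xA equiv_class_eq[OF E] by auto
      moreover have "x \<in> topspace T"
        using xA openin_subset[OF V(2)] by blast
      ultimately show "x \<in> topspace T \<and> E `` {x} \<in> V" using xA by simp
    qed
  qed
  then show "openin T {x \<in> topspace T. E `` {x} \<in> V}"
    using V(2) by simp
qed

lemma open_map_quotient_topology:
  assumes "\<And>U. openin T U \<Longrightarrow> openin T (E `` U)"
  shows "open_map T (quotient_topology T E) (\<lambda>x. E `` {x})"
  unfolding open_map_def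
proof (intro allI impI)
  fix U assume U: "openin T U"
  have "\<Union>((\<lambda>x. E `` {x}) ` U) = E `` U" by auto
  then show "openin (quotient_topology T E) ((\<lambda>x. E `` {x}) ` U)"
    using assms[OF U] openin_subset[OF U] by (auto simp: openin_quotient_topology quotientI)
qed

end

text \<open>A continuous open map restricts to an embedding with open image on every open set where
  it is injective.\<close>

lemma local_homeomorphismI:
  assumes cont: "continuous_map S T f" and op: "open_map S T f"
    and inj: "\<And>x. x \<in> topspace S \<Longrightarrow> \<exists>U. openin S U \<and> x \<in> U \<and> inj_on f U"
  shows "local_homeomorphism S T f"
  unfolding local_homeomorphism_def
proof (intro conjI ballI)
  show "f ` topspace S \<subseteq> topspace T"
    using cont by (rule continuous_map_image_subset_topspace)
  fix x assume "x \<in> topspace S"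
  then obtain U where U: "openin S U" "x \<in> U" "inj_on f U" using inj by blast
  then have top: "topspace (subtopology S U) = U"
    using openin_subset by fastforce
  have "embedding_map (subtopology S U) T f"
  proof (rule injective_open_imp_embedding_map)
    show "open_map (subtopology S U) T f"
      using op U(1) by (simp add: open_map_def openin_open_subtopology)
  qed (use cont U(3) top in \<open>auto intro: continuous_map_from_subtopology\<close>)
  then have "homeomorphic_map (subtopology S U) (subtopology T (f ` U)) f"
    by (simp only: embedding_map_def top)
  moreover have "openin T (f ` U)"
    using op U(1) by (simp add: open_map_def)
  ultimately show "\<exists>U. openin S U \<and> x \<in> U \<and> openin T (f ` U) \<and>
      homeomorphic_map (subtopology S U) (subtopology T (f ` U)) f"
    using U by blast
qed

section \<open>The quotient by the chain relation\<close>

locale stable_chain_space = smale_space X d \<phi> \<epsilon> lam br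
  for X :: "'a set" and d \<phi> \<epsilon> lam br +
  fixes \<delta> \<eta> :: real
  assumes eta_pos: "0 < \<eta>" and eta_le: "\<eta> \<le> \<delta>" and delta_le: "4 * \<delta> \<le> \<epsilon>"
    and chain_bounded: "\<And>x c. \<lbrakk>x \<in> X; (x, c) \<in> (stable_step \<eta>)\<^sup>*\<rbrakk> \<Longrightarrow> d x c < \<delta> \<and> br x c = c"
    and expansive: "\<And>x y. \<lbrakk>x \<in> X; y \<in> X; \<And>n. d ((\<phi> ^^ n) x) ((\<phi> ^^ n) y) \<le> 3 * \<delta>\<rbrakk> \<Longrightarrow> br x y = y"
begin

text \<open>\<open>stable_step \<eta>\<close> is reflexive on \<open>X\<close>, so the transitive
  closure already is; the reflexive-transitive closure would also relate points outside
  \<open>X\<close> to themselves.\<close>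

definition E :: "('a \<times> 'a) set" where "E = (stable_step \<eta>)\<^sup>+"

abbreviation cl :: "'a \<Rightarrow> 'a set" where "cl x \<equiv> E `` {x}"

lemma stable_stepI: "\<lbrakk>x \<in> X; y \<in> X; d x y < \<eta>; br x y = y\<rbrakk> \<Longrightarrow> (x, y) \<in> stable_step \<eta>"
  by (simp add: stable_step_def)

lemma stable_stepD:
  assumes "(x, y) \<in> stable_step \<eta>"
  shows "x \<in> X" "y \<in> X" "d x y < \<eta>" "br x y = y"
  using assms by (auto simp: stable_step_def)

lemma E_imp_stable:
  assumes "(x, y) \<in> E"
  shows "x \<in> X" "y \<in> X" "d x y < \<delta>" "br x y = y"
proof -
  have sub: "stable_step \<eta> \<subseteq> X \<times> X" by (auto simp: stable_step_def)
  show x: "x \<in> X" and "y \<in> X"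
    using trancl_subset_Sigma[OF sub] assms by (auto simp: E_def)
  have "(x, y) \<in> (stable_step \<eta>)\<^sup>*"
    using assms unfolding E_def by (rule trancl_into_rtrancl)
  then show "d x y < \<delta>" "br x y = y"
    using chain_bounded[OF x] by blast+
qed

lemma stable_in_E: "\<lbrakk>x \<in> X; y \<in> X; d x y < \<eta>; br x y = y\<rbrakk> \<Longrightarrow> (x, y) \<in> E"
  unfolding E_def by (intro r_into_trancl stable_stepI)

lemma equiv_E: "equiv X E"
proof (rule equivI)
  show "E \<subseteq> X \<times> X" by (auto dest: E_imp_stable(1,2))
  show "refl_on X E"
  proof (rule refl_onI)
    fix x assume "x \<in> X"
    then show "(x, x) \<in> E" using eta_pos by (intro stable_in_E) (simp_all add: br_idem)
  qed
  have "sym (stable_step \<eta>)"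
  proof (rule symI)
    fix x y assume "(x, y) \<in> stable_step \<eta>"
    note xy = stable_stepD[OF this]
    have "d x y \<le> \<epsilon>" using xy(3) eta_le delta_le eta_pos by linarith
    then show "(y, x) \<in> stable_step \<eta>"
      using stable_stepI[OF xy(2,1)] xy stable_sym[OF xy(1,2) _ xy(4)] commute[of x y] by simp
  qed
  then show "sym E" unfolding E_def by (rule sym_trancl)
  show "trans E" unfolding E_def by (rule trans_trancl)
qed

lemma cl_eq_iff: "\<lbrakk>x \<in> X; y \<in> X\<rbrakk> \<Longrightarrow> cl x = cl y \<longleftrightarrow> (x, y) \<in> E"
  using eq_equiv_class_iff[OF equiv_E] .

lemma stable_step_\<phi>:
  assumes "(u, v) \<in> stable_step \<eta>"
  shows "(\<phi> u, \<phi> v) \<in> stable_step \<eta>"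
proof -
  note uv = stable_stepD[OF assms]
  have "d u v \<le> \<epsilon>" using uv(3) eta_le delta_le eta_pos by linarith
  note * = stable_\<phi>[OF uv(1,2) this uv(4)]
  show ?thesis
    using *(2,3) uv(1-3) by (intro stable_stepI) simp_all
qed

lemma E_\<phi>: "(x, y) \<in> E \<Longrightarrow> (\<phi> x, \<phi> y) \<in> E"
  unfolding E_def
proof (induction rule: trancl_induct)
  case (base y)
  then show ?case using stable_step_\<phi> by blast
next
  case (step y z)
  then show ?case using stable_step_\<phi> by (meson trancl_into_trancl)
qed

text \<open>If \<open>x\<close> steps to \<open>y\<close> and \<open>y'\<close> is near
  \<open>y\<close>, then \<open>br y' x\<close> is near \<open>br y x = x\<close>, hence in
  \<open>U\<close>, and it steps to \<open>y'\<close>.\<close>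

lemma openin_stable_step:
  assumes "openin mtopology U"
  shows "openin mtopology (stable_step \<eta> `` U)"
  unfolding openin_mtopology
proof (intro conjI allI impI)
  show "stable_step \<eta> `` U \<subseteq> X" by (auto simp: stable_step_def)
  fix y assume "y \<in> stable_step \<eta> `` U"
  then obtain x where x: "x \<in> U" and "(x, y) \<in> stable_step \<eta>" by blast
  note xy = stable_stepD[OF this(2)]
  obtain e where e: "e > 0" "mball x e \<subseteq> U"
    using assms x by (auto simp: openin_mtopology)
  \<comment> \<open>Half the slack of the step: one half pays for moving \<open>x\<close>, the other
    for moving \<open>y\<close>.\<close>
  define q where "q = (\<eta> - d x y) / 2"
  have q: "2 * q = \<eta> - d x y" "0 < q" using xy(3) by (simp_all add: q_def)
  let ?e = "min e q"
  have le: "d y x \<le> \<epsilon>" "d y x < \<eta>"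
    using xy(3) eta_le delta_le eta_pos commute[of x y] by linarith+
  have "0 < ?e" using e q by simp
  then obtain \<gamma> where \<gamma>: "0 < \<gamma>" "\<And>x y x' y'. \<lbrakk>x \<in> X; y \<in> X; x' \<in> X; y' \<in> X; d x y \<le> \<epsilon>; d x' y' \<le> \<epsilon>; d x x' < \<gamma>; d y y' < \<gamma>\<rbrakk>
       \<Longrightarrow> d (br x y) (br x' y') < ?e"
    using br_uniform by blast
  define r where "r = min \<gamma> q"
  have r: "r \<le> \<gamma>" "r \<le> q"
    unfolding r_def by (rule min.cobounded1, rule min.cobounded2)
  have "0 < r" using \<gamma>(1) q by (simp add: r_def)
  have "y' \<in> stable_step \<eta> `` U" if "y' \<in> mball y r" for y'
  proof -
    have y': "y' \<in> X" "d y y' < r" using that by auto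
    define x' where "x' = br y' x"
    have "d y' x \<le> d y y' + d x y"
      using triangle[OF y'(1) xy(2,1)] by (simp only: commute[of y y'] commute[of y x])
    moreover have "d y y' < q"
      using y'(2) r(2) by linarith
    ultimately have "d y' x < \<eta>"
      using xy(3) q by linarith
    then have d: "d y' x \<le> \<epsilon>"
      using eta_le delta_le eta_pos by linarith
    have x': "x' \<in> X" unfolding x'_def using br_in[OF y'(1) xy(1) d] .
    have "br y x = x"
      using stable_sym[OF xy(1,2) _ xy(4)] le(1) by (simp only: commute[of x y])
    moreover have "d (br y x) (br y' x) < ?e"
      by (rule \<gamma>(2)) (use y' xy le d r \<gamma>(1) in auto)
    ultimately have "d x x' < ?e" by (simp add: x'_def)
    then have "x' \<in> U" and dxx': "d x x' < q"
      using e xy(1) x' by auto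
    have "d x' y' \<le> d x' x + (d x y + d y y')"
      using triangle[OF x' xy(1) y'(1)] triangle[OF xy(1,2) y'(1)] by linarith
    then have dx'y': "d x' y' < \<eta>"
      using dxx' y'(2) r(2) q commute[of x x'] by linarith
    then have dy'x': "d y' x' \<le> \<epsilon>"
      using commute[of x' y'] eta_le delta_le eta_pos by linarith
    have "br y' (br y' x) = br y' x"
      using br_right[OF y'(1) y'(1) xy(1) d _ d] dy'x' by (simp only: x'_def)
    then have "br x' y' = y'"
      using stable_sym[OF y'(1) x' dy'x'] by (simp add: x'_def)
    then show ?thesis
      using \<open>x' \<in> U\<close> x' y' dx'y' stable_stepI by blast
  qed
  then show "\<exists>r>0. mball y r \<subseteq> stable_step \<eta> `` U"
    using \<open>0 < r\<close> by (intro exI[of _ r] conjI subsetI)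
qed

text \<open>A chain is followed one step at a time, taking the image of an open neighbourhood
  already reached. This makes the projection to the quotient open.\<close>

lemma openin_E:
  assumes "openin mtopology U"
  shows "openin mtopology (E `` U)"
proof (subst openin_subopen, intro ballI)
  fix y assume "y \<in> E `` U"
  then obtain x where x: "x \<in> U" and "(x, y) \<in> E" by blast
  from this(2) show "\<exists>T. openin mtopology T \<and> y \<in> T \<and> T \<subseteq> E `` U"
    unfolding E_def
  proof (induction rule: trancl_induct)
    case (base y)
    have "stable_step \<eta> `` U \<subseteq> (stable_step \<eta>)\<^sup>+ `` U" by (rule Image_mono) auto
    then show ?case
      using x base openin_stable_step[OF assms] by blast
  next
    case (step y z)
    then obtain T where T: "openin mtopology T" "y \<in> T" "T \<subseteq> (stable_step \<eta>)\<^sup>+ `` U" by blast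
    moreover have "stable_step \<eta> `` T \<subseteq> (stable_step \<eta>)\<^sup>+ `` U"
    proof
      fix w assume "w \<in> stable_step \<eta> `` T"
      then obtain v where "v \<in> T" "(v, w) \<in> stable_step \<eta>" by blast
      then show "w \<in> (stable_step \<eta>)\<^sup>+ `` U"
        using T(3) by (meson Image_iff subsetD trancl_into_trancl)
    qed
    moreover have "z \<in> stable_step \<eta> `` T"
      using step.hyps(2) T(2) by blast
    ultimately show ?case
      using openin_stable_step[OF T(1)] by blast
  qed
qed

section \<open>The quotient system\<close>

definition Y :: "'a set topology" where "Y = quotient_topology mtopology E"

text \<open>Saturating the image avoids a choice of representatives; on a class it yields the class
  of the image of any member, because \<open>\<phi>\<close> preserves \<open>E\<close>.\<close>

definition g :: "'a set \<Rightarrow> 'a set" where "g A = E `` (\<phi> ` A)"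

lemma topspace_Y: "topspace Y = X // E"
  unfolding Y_def using topspace_quotient_topology[of mtopology E] equiv_E by simp

lemma Y_cases:
  assumes "A \<in> topspace Y"
  obtains x where "x \<in> X" "A = cl x"
  using assms unfolding topspace_Y by (rule quotientE) (rule that)

lemma cl_in_Y: "x \<in> X \<Longrightarrow> cl x \<in> topspace Y"
  unfolding topspace_Y by (rule quotientI)

lemma cl_image: "cl ` X = topspace Y"
  using Y_cases cl_in_Y by blast

lemma continuous_cl: "continuous_map mtopology Y cl"
  unfolding Y_def using continuous_map_quotient_topology[of mtopology E] equiv_E by simp

lemma open_cl: "open_map mtopology Y cl"
  unfolding Y_def using open_map_quotient_topology[of mtopology E] equiv_E openin_E by simp

lemma g_cl:
  assumes "x \<in> X"
  shows "g (cl x) = cl (\<phi> x)"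
proof -
  have "x \<in> cl x" using equiv_class_self[OF equiv_E assms] .
  moreover have "cl (\<phi> y) = cl (\<phi> x)" if "y \<in> cl x" for y
    using equiv_class_eq[OF equiv_E E_\<phi>[of x y]] that by simp
  moreover have "g (cl x) = (\<Union>y\<in>cl x. cl (\<phi> y))"
    unfolding g_def by blast
  ultimately show ?thesis by blast
qed

lemma g_pow_cl: "x \<in> X \<Longrightarrow> (g ^^ n) (cl x) = cl ((\<phi> ^^ n) x)"
  by (induction n) (simp_all add: g_cl)

lemma g_surj: "g ` topspace Y = topspace Y"
proof -
  have "(\<lambda>x. g (cl x)) ` X = (\<lambda>x. cl (\<phi> x)) ` X"
    using g_cl by (rule image_cong[OF refl])
  then have "g ` cl ` X = cl ` \<phi> ` X"
    by (simp only: image_image)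
  then show ?thesis by (simp add: \<phi>_surj cl_image)
qed

lemma compact_Y: "compact_space Y"
  using image_compactin[of mtopology X Y cl] compact continuous_cl
  by (simp add: compact_space_def cl_image)

lemma continuous_g: "continuous_map Y Y g"
proof -
  have "quotient_map mtopology Y cl"
    using continuous_cl open_cl cl_image by (intro continuous_open_imp_quotient_map) auto
  moreover have "continuous_map mtopology Y (cl \<circ> \<phi>)"
    using continuous_\<phi> continuous_cl by (rule continuous_map_compose)
  then have "continuous_map mtopology Y (g \<circ> cl)"
    by (rule continuous_map_eq) (simp add: g_cl)
  ultimately show ?thesis
    using continuous_compose_quotient_map by blast
qed

lemma open_g: "open_map Y Y g"
  unfolding open_map_def
proof (intro allI impI)
  fix U assume U: "openin Y U"
  let ?W = "{x \<in> topspace mtopology. cl x \<in> U}"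
  have "openin mtopology ?W"
    using continuous_cl U by (rule openin_continuous_map_preimage)
  then have "openin mtopology (\<phi> ` ?W)"
    using homeomorphic_imp_open_map[OF homeo] unfolding open_map_def by blast
  then have "openin Y (cl ` \<phi> ` ?W)"
    using open_cl unfolding open_map_def by blast
  moreover have "U \<subseteq> cl ` X"
    using openin_subset[OF U] by (simp only: cl_image)
  then have "U = cl ` ?W"
    unfolding topspace_mtopology by blast
  from arg_cong[OF this, of "image g"] have "g ` U = (\<lambda>x. g (cl x)) ` ?W"
    by (simp only: image_image)
  moreover have "(\<lambda>x. g (cl x)) ` ?W = (\<lambda>x. cl (\<phi> x)) ` ?W"
    by (rule image_cong) (simp_all add: g_cl)
  then have "(\<lambda>x. g (cl x)) ` ?W = cl ` \<phi> ` ?W"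
    by (simp only: image_image)
  ultimately show "openin Y (g ` U)" by simp
qed

lemma local_homeomorphism_g: "local_homeomorphism Y Y g"
proof (rule local_homeomorphismI[OF continuous_g open_g])
  fix A assume "A \<in> topspace Y"
  then obtain z where z: "z \<in> X" "A = cl z" by (rule Y_cases)
  \<comment> \<open>Points of this ball are less than \<open>\<eta>\<close> apart, so once stably
    related they are joined by one step.\<close>
  let ?B = "mball z (\<eta> / 2)"
  have "openin Y (cl ` ?B)"
    using open_cl by (simp add: open_map_def)
  moreover have "A \<in> cl ` ?B"
    using z eta_pos by simp
  moreover have "inj_on g (cl ` ?B)"
  proof (intro inj_onI, clarify)
    fix x y assume xB: "x \<in> ?B" and yB: "y \<in> ?B" and eq: "g (cl x) = g (cl y)"
    have xy: "x \<in> X" "y \<in> X" "d z x < \<eta> / 2" "d z y < \<eta> / 2" using xB yB by auto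
    have d: "d x y < \<eta>"
      using triangle[OF xy(1) z(1) xy(2)] xy(3,4) commute[of z x] by linarith
    have "(\<phi> x, \<phi> y) \<in> E"
      using eq xy cl_eq_iff by (simp add: g_cl)
    note * = E_imp_stable[OF this]
    have le: "d x y \<le> \<epsilon>" "d (\<phi> x) (\<phi> y) \<le> \<epsilon>"
      using d *(3) eta_le delta_le eta_pos by linarith+
    \<comment> \<open>By equivariance this is \<open>br (\<phi> x) (\<phi> y)\<close>; injectivity
      of \<open>\<phi>\<close> then pulls the stable relation back.\<close>
    have "\<phi> (br x y) = \<phi> y"
      using br_equivariant[OF xy(1,2) le] *(4) by simp
    then have "br x y = y"
      using inj_onD[OF \<phi>_inj] br_in[OF xy(1,2) le(1)] xy(2) by blast
    then show "cl x = cl y"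
      using stable_in_E[OF xy(1,2) d] xy cl_eq_iff by blast
  qed
  ultimately show "\<exists>U. openin Y U \<and> A \<in> U \<and> inj_on g U" by blast
qed

text \<open>The cover consists of the images of finitely many balls of radius
  \<open>\<eta> / 2\<close>. Classes in a common member have representatives less than
  \<open>\<eta>\<close> apart, and classes have radius below \<open>\<delta>\<close>, so the orbits
  in \<open>X\<close> stay within \<open>3 * \<delta>\<close>.\<close>

lemma forward_orbit_expansive_g: "forward_orbit_expansive Y g"
proof -
  have "mtotally_bounded X"
    using compact compact_space_eq_mcomplete_mtotally_bounded by blast
  then obtain F where F: "finite F" "F \<subseteq> X" "X \<subseteq> (\<Union>x\<in>F. mball x (\<eta> / 2))"
    unfolding mtotally_bounded_def using eta_pos by (meson half_gt_zero)
  let ?\<U> = "(\<lambda>x. cl ` mball x (\<eta> / 2)) ` F"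
  have "X = (\<Union>x\<in>F. mball x (\<eta> / 2))"
    using F(3) mball_subset_mspace by blast
  then have "cl ` X = \<Union>?\<U>"
    by blast
  then have "\<Union>?\<U> = topspace Y"
    by (simp only: cl_image)
  moreover have "\<forall>U\<in>?\<U>. openin Y U"
    using open_cl by (auto simp: open_map_def)
  moreover have eq: "A = B" if A: "A \<in> topspace Y" and B: "B \<in> topspace Y"
    and *: "\<And>n. \<exists>U\<in>?\<U>. (g ^^ n) A \<in> U \<and> (g ^^ n) B \<in> U" for A B
  proof -
    obtain x where x: "x \<in> X" "A = cl x" using A by (rule Y_cases)
    obtain y where y: "y \<in> X" "B = cl y" using B by (rule Y_cases)
    have ex: "\<exists>u v. ((\<phi> ^^ n) x, u) \<in> E \<and> ((\<phi> ^^ n) y, v) \<in> E \<and> d u v < \<eta>" for n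
    proof -
      obtain a where a: "a \<in> F" "cl ((\<phi> ^^ n) x) \<in> cl ` mball a (\<eta> / 2)" "cl ((\<phi> ^^ n) y) \<in> cl ` mball a (\<eta> / 2)"
        using *[of n] unfolding x(2) y(2) g_pow_cl[OF x(1)] g_pow_cl[OF y(1)] by blast
      obtain u where u: "u \<in> mball a (\<eta> / 2)" "cl ((\<phi> ^^ n) x) = cl u" using a(2) by blast
      obtain v where v: "v \<in> mball a (\<eta> / 2)" "cl ((\<phi> ^^ n) y) = cl v" using a(3) by blast
      have uX: "u \<in> X" "v \<in> X" "a \<in> X" using u v by auto
      have "d u v \<le> d a u + d a v"
        using triangle[OF uX(1,3,2)] commute[of a u] by simp
      then have "d u v < \<eta>" using u(1) v(1) by simp
      moreover have "((\<phi> ^^ n) x, u) \<in> E" "((\<phi> ^^ n) y, v) \<in> E"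
        using cl_eq_iff u(2) v(2) uX x y by simp_all
      ultimately show ?thesis by blast
    qed
    have close: "d ((\<phi> ^^ n) x) ((\<phi> ^^ n) y) \<le> 3 * \<delta>" for n
    proof -
      obtain u v where uv: "((\<phi> ^^ n) x, u) \<in> E" "((\<phi> ^^ n) y, v) \<in> E" "d u v < \<eta>"
        using ex by blast
      note u = E_imp_stable[OF uv(1)] and v = E_imp_stable[OF uv(2)]
      show ?thesis
        using triangle[OF u(1,2) v(1)] triangle[OF u(2) v(2,1)] u(3) v(3) uv(3) eta_le
          commute[of v "(\<phi> ^^ n) y"] by linarith
    qed
    \<comment> \<open>Expansiveness relates \<open>x\<close> and \<open>y\<close>, but they may be
      too far apart for a single step. The relation is therefore carried over to the representatives
      \<open>u\<close> and \<open>v\<close> at time 0, which are less than \<open>\<eta>\<close>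
      apart.\<close>
    obtain u v where "((\<phi> ^^ 0) x, u) \<in> E" "((\<phi> ^^ 0) y, v) \<in> E" and duv: "d u v < \<eta>"
      using ex by blast
    then have uE: "(x, u) \<in> E" and vE: "(y, v) \<in> E" by simp_all
    note u = E_imp_stable[OF uE] and v = E_imp_stable[OF vE]
    have dxy: "d x y \<le> 3 * \<delta>" using close[of 0] by simp
    have le: "\<delta> \<le> \<epsilon>" "3 * \<delta> \<le> \<epsilon>" "0 < \<delta>" using eta_le delta_le eta_pos by linarith+
    have dxv: "d x v \<le> \<epsilon>"
      using triangle[OF x(1) y(1) v(2)] dxy v(3) delta_le by linarith
    have "br x v = v"
      by (rule stable_trans[OF x(1) y(1) v(2) _ _ dxv expansive[OF x(1) y(1) close] v(4)])
        (use dxy v(3) le in linarith)+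
    moreover have "br u x = x"
      by (rule stable_sym[OF x(1) u(2) _ u(4)]) (use u(3) le in linarith)
    ultimately have "br u v = v"
      by (intro stable_trans[OF u(2) x(1) v(2) _ dxv])
        (use u(3) le duv eta_le commute[of u x] in linarith)+
    then have "(u, v) \<in> E" using stable_in_E u(2) v(2) duv by blast
    then have "(x, y) \<in> E"
      using equiv_class_eq[OF equiv_E uE] equiv_class_eq[OF equiv_E vE] equiv_class_eq[OF equiv_E, of u v]
        cl_eq_iff[OF x(1) y(1)] by simp
    then show ?thesis
      unfolding x(2) y(2) by (rule equiv_class_eq[OF equiv_E])
  qed
  ultimately show ?thesis
    unfolding forward_orbit_expansive_def using finite_imageI[OF F(1)]
    by (intro exI[of _ ?\<U>] conjI ballI impI eq) (assumption | erule spec | blast)+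
qed

text \<open>A limit point of the class lies in the same closed local stable set, hence is one step
  away from any member of the class closer than \<open>\<eta>\<close>.\<close>

lemma closedin_cl:
  assumes x: "x \<in> X"
  shows "closedin mtopology (cl x)"
proof -
  have "mtopology closure_of cl x \<subseteq> cl x"
  proof
    fix y assume y: "y \<in> mtopology closure_of cl x"
    have "cl x \<subseteq> closed_local_stable_set x \<delta>"
    proof
      fix z assume "z \<in> cl x"
      then have "(x, z) \<in> E" by simp
      from E_imp_stable[OF this] show "z \<in> closed_local_stable_set x \<delta>" by (simp add: closed_local_stable_set_def)
    qed
    moreover have "\<delta> \<le> \<epsilon>" using delta_le eta_le eta_pos by linarith
    ultimately have "y \<in> closed_local_stable_set x \<delta>"
      using closure_of_minimal[OF _ closedin_closed_local_stable_set[OF x]] y by blast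
    obtain z where z: "z \<in> cl x" "z \<in> mball y \<eta>"
      using y eta_pos by (auto simp: metric_closure_of)
    have "2 * \<delta> \<le> \<epsilon>" using delta_le eta_le eta_pos by linarith
    then have "br z y = y"
      using stable_within_closed_local_stable_set(2)[OF x] z(1) \<open>cl x \<subseteq> closed_local_stable_set x \<delta>\<close> \<open>y \<in> closed_local_stable_set x \<delta>\<close> by blast
    then have "(z, y) \<in> E"
      using z(2) by (intro stable_in_E) (auto simp: commute)
    then show "y \<in> cl x"
      using z(1) equiv_E by (auto elim: equivE dest: transD)
  qed
  moreover have "cl x \<subseteq> topspace mtopology" by (auto dest: E_imp_stable(2))
  ultimately show ?thesis
    by (meson closure_of_subset closure_of_eq subset_antisym)
qed

section \<open>The conjugacy with the solenoid\<close>

definition h :: "'a \<Rightarrow> nat \<Rightarrow> 'a set" where "h x n = cl ((\<psi> ^^ n) x)"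

lemma topspace_solenoid:
  "topspace (solenoid Y g) = {y. (\<forall>n. y n \<in> topspace Y) \<and> (\<forall>n. g (y (Suc n)) = y n)}"
  by (auto simp: solenoid_def)

lemma h_in: 
  assumes "x \<in> X"
  shows "h x \<in> topspace (solenoid Y g)"
  using assms by (simp add: topspace_solenoid h_def cl_in_Y g_cl)

lemma continuous_h: "continuous_map mtopology (solenoid Y g) h"
proof -
  have "continuous_map mtopology mtopology (\<psi> ^^ n)" for n
    using continuous_\<psi> by (induction n) (auto intro: continuous_map_compose simp: id_def)
  then have "continuous_map mtopology Y (cl \<circ> (\<psi> ^^ n))" for n
    using continuous_cl continuous_map_compose by blast
  moreover have "(\<lambda>x. h x n) = cl \<circ> (\<psi> ^^ n)" for n
    by (auto simp: h_def)
  ultimately have "continuous_map mtopology (product_topology (\<lambda>_. Y) UNIV) h"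
    by (simp add: continuous_map_componentwise_UNIV)
  then show ?thesis
    using h_in unfolding solenoid_def
    by (auto simp: continuous_map_in_subtopology topspace_solenoid)
qed

lemma E_contract_\<phi>_pow: "(x, y) \<in> E \<Longrightarrow> d ((\<phi> ^^ n) x) ((\<phi> ^^ n) y) \<le> lam ^ n * \<delta>"
proof -
  assume "(x, y) \<in> E"
  note xy = E_imp_stable[OF this]
  have "d x y \<le> \<epsilon>" using xy(3) eta_le delta_le eta_pos by linarith
  then have "d ((\<phi> ^^ n) x) ((\<phi> ^^ n) y) \<le> lam ^ n * d x y"
    using stable_\<phi>_pow[OF xy(1,2) _ xy(4)] by blast
  also have "\<dots> \<le> lam ^ n * \<delta>"
    using xy(3) lam_pos by (intro mult_left_mono) auto
  finally show ?thesis .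
qed

lemma lam_pow_small:
  assumes "0 < r"
  shows "\<exists>n. lam ^ n * \<delta> < r"
proof -
  have "(\<lambda>n. lam ^ n * \<delta>) \<longlonglongrightarrow> 0"
    using lam_pos lam_less_1 by (intro tendsto_mult_left_zero LIMSEQ_power_zero) auto
  then have "eventually (\<lambda>n. lam ^ n * \<delta> < r) sequentially"
    using assms by (rule order_tendstoD)
  then show ?thesis by (rule eventually_happens'[OF sequentially_bot])
qed

text \<open>Equal \<open>n\<close>-th coordinates mean that the \<open>n\<close>-th preimages are
  equivalent; applying \<open>\<phi> ^^ n\<close> gives
  \<open>d x y \<le> lam ^ n * \<delta>\<close>.\<close>

lemma inj_h: "inj_on h X"
proof (rule inj_onI)
  fix x y assume x: "x \<in> X" and y: "y \<in> X" and eq: "h x = h y"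
  have le: "d x y \<le> lam ^ n * \<delta>" for n
  proof -
    have "cl ((\<psi> ^^ n) x) = cl ((\<psi> ^^ n) y)"
      using fun_cong[OF eq, of n] by (simp add: h_def)
    then have "((\<psi> ^^ n) x, (\<psi> ^^ n) y) \<in> E"
      using cl_eq_iff x y by simp
    from E_contract_\<phi>_pow[OF this, of n] show ?thesis
      using x y by simp
  qed
  show "x = y"
  proof (rule ccontr)
    assume "x \<noteq> y"
    then have "0 < d x y" using x y by simp
    then obtain n where "lam ^ n * \<delta> < d x y" using lam_pow_small by blast
    then show False using le[of n] by linarith
  qed
qed

lemma surj_h: "h ` X = topspace (solenoid Y g)"
proof
  show "h ` X \<subseteq> topspace (solenoid Y g)" using h_in by blast
  show "topspace (solenoid Y g) \<subseteq> h ` X"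
  proof
    fix y assume "y \<in> topspace (solenoid Y g)"
    then have y: "\<And>n. y n \<in> topspace Y" "\<And>n. g (y (Suc n)) = y n"
      by (auto simp: topspace_solenoid)
    define C where "C n = (\<phi> ^^ n) ` y n" for n
    have clo: "closedin mtopology (C n)" for n
    proof -
      obtain x where x: "x \<in> X" "y n = cl x" using y(1) by (rule Y_cases)
      have "closed_map mtopology mtopology (\<phi> ^^ n)"
      proof (induction n)
        case (Suc n)
        then show ?case
          using closed_map_compose homeomorphic_imp_closed_map[OF homeo] by (simp only: funpow.simps)
      qed (simp add: closed_map_def)
      then show ?thesis
        using closedin_cl[OF x(1)] x(2) by (simp add: C_def closed_map_def)
    qed
    have ne: "C n \<noteq> {}" for n
    proof -
      obtain x where x: "x \<in> X" "y n = cl x" using y(1) by (rule Y_cases)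
      then have "x \<in> y n" using equiv_class_self[OF equiv_E] by blast
      then show ?thesis by (auto simp: C_def)
    qed
    have "C (Suc n) \<subseteq> C n" for n
    proof -
      have "y (Suc n) \<subseteq> X"
        using y(1)[of "Suc n"] unfolding topspace_Y using Union_quotient[OF equiv_E] by blast
      then have "\<phi> ` y (Suc n) \<subseteq> X"
        using \<phi>_in by blast
      then have "\<phi> ` y (Suc n) \<subseteq> g (y (Suc n))"
        unfolding g_def using equiv_class_self[OF equiv_E] by blast
      then have "\<phi> ` y (Suc n) \<subseteq> y n" using y(2) by simp
      then have "(\<phi> ^^ n) ` \<phi> ` y (Suc n) \<subseteq> C n"
        unfolding C_def by (rule image_mono)
      then show ?thesis by (simp add: C_def funpow_Suc_right image_comp del: funpow.simps)
    qed
    then have "decseq C" by (rule decseq_SucI)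
    then have "(\<Inter>n. C n) \<noteq> {}"
      by (rule compact_space_imp_nest[OF compact clo ne])
    then obtain x where x: "\<And>n. x \<in> C n" by blast
    have xX: "x \<in> X" using x[of 0] closedin_subset[OF clo[of 0]] by auto
    have "y n = h x n" for n
    proof -
      obtain z where z: "z \<in> X" "y n = cl z" using y(1) by (rule Y_cases)
      obtain w where w: "w \<in> y n" "x = (\<phi> ^^ n) w" using x[of n] by (auto simp: C_def)
      have "(z, w) \<in> E" using w(1) z(2) by simp
      then have "cl z = cl w" "w = (\<psi> ^^ n) x"
        using w(2) E_imp_stable(2)[of z w] equiv_class_eq[OF equiv_E, of z w] by simp_all
      then show ?thesis using z(2) by (simp add: h_def)
    qed
    then have "y = h x" by blast
    then show "y \<in> h ` X" using xX by blast
  qed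
qed

lemma open_h: "open_map mtopology (solenoid Y g) h"
  unfolding open_map_def
proof (intro allI impI)
  fix U assume U: "openin mtopology U"
  show "openin (solenoid Y g) (h ` U)"
  proof (subst openin_subopen, intro ballI)
    fix y assume "y \<in> h ` U"
    then obtain x where x: "x \<in> U" "y = h x" by blast
    then have xX: "x \<in> X" using openin_subset[OF U] by auto
    obtain e where e: "e > 0" "mball x e \<subseteq> U"
      using U x(1) by (auto simp: openin_mtopology)
    then obtain n where n: "lam ^ n * \<delta> < e / 2"
      using lam_pow_small[of "e / 2"] by auto
    let ?W = "{w \<in> topspace mtopology. (\<phi> ^^ n) w \<in> mball x (e / 2)}"
    let ?T = "{s \<in> topspace (solenoid Y g). s n \<in> cl ` ?W}"
    have "continuous_map mtopology mtopology (\<phi> ^^ n)"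
      using continuous_\<phi> by (induction n) (auto intro: continuous_map_compose simp: id_def)
    then have "openin mtopology ?W"
      by (rule openin_continuous_map_preimage) simp
    then have "openin Y (cl ` ?W)"
      using open_cl by (simp add: open_map_def)
    moreover have "continuous_map (solenoid Y g) Y (\<lambda>s. s n)"
      unfolding solenoid_def
      by (intro continuous_map_from_subtopology continuous_map_product_projection) simp
    ultimately have "openin (solenoid Y g) ?T"
      by (intro openin_continuous_map_preimage)
    moreover have "y \<in> ?T"
      using x(2) xX e(1) h_in[OF xX] by (auto simp: h_def intro!: imageI)
    moreover have "?T \<subseteq> h ` U"
    proof
      fix s assume s: "s \<in> ?T"
      then obtain x' where x': "x' \<in> X" "s = h x'" using surj_h by blast
      obtain w where w: "w \<in> X" "(\<phi> ^^ n) w \<in> mball x (e / 2)" "s n = cl w"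
        using s by auto
      then have "((\<psi> ^^ n) x', w) \<in> E"
        using x' cl_eq_iff by (simp add: h_def)
      from E_contract_\<phi>_pow[OF this, of n] have "d x' ((\<phi> ^^ n) w) < e / 2"
        using n x'(1) by simp
      then have "d x x' < e"
        using triangle[OF xX \<phi>_pow_in[OF w(1), of n] x'(1)] w(2) commute[of x' "(\<phi> ^^ n) w"] by simp
      then show "s \<in> h ` U" using e(2) x' xX by auto
    qed
    ultimately show "\<exists>T. openin (solenoid Y g) T \<and> y \<in> T \<and> T \<subseteq> h ` U"
      by (intro exI[of _ ?T] conjI)
  qed
qed

lemma conjugate_solenoid: "conjugate mtopology \<phi> (solenoid Y g) (solenoid_map g)"
  unfolding conjugate_def
proof (intro exI[of _ h] conjI ballI)
  show "homeomorphic_map mtopology (solenoid Y g) h"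
    using continuous_h open_h surj_h inj_h by (intro bijective_open_imp_homeomorphic_map) auto
  fix x assume "x \<in> topspace mtopology"
  then have x: "x \<in> X" by simp
  show "h (\<phi> x) = solenoid_map g (h x)"
  proof
    fix n
    show "h (\<phi> x) n = solenoid_map g (h x) n"
      \<comment> \<open>Coordinate 0 is the rule for \<open>g\<close> on classes; in the others one
        \<open>\<psi>\<close> cancels \<open>\<phi>\<close>.\<close>
      using x by (cases n) (simp_all add: h_def solenoid_map_def g_cl funpow_Suc_right del: funpow.simps(2))
  qed
qed

end

theorem corollary3p12:
  fixes X :: "'a set" and d :: "'a \<Rightarrow> 'a \<Rightarrow> real"
    and \<phi> :: "'a \<Rightarrow> 'a" and \<epsilon> lam :: real and br :: "'a \<Rightarrow> 'a \<Rightarrow> 'a"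
  assumes "smale_space X d \<phi> \<epsilon> lam br"
    and "smale_space.irreducible X d \<phi>"
    and "infinite X"
    and "\<forall>x\<in>X. totally_disconnected_space (smale_space.stable_topology X d \<phi> \<epsilon> br x)"
  shows "\<exists>(Y :: 'a set topology) (g :: 'a set \<Rightarrow> 'a set).
           compact_space Y \<and>
           g ` topspace Y = topspace Y \<and>
           local_homeomorphism Y Y g \<and>
           forward_orbit_expansive Y g \<and>
           conjugate (Metric_space.mtopology X d) \<phi> (solenoid Y g) (solenoid_map g)"
proof -
  interpret smale_space X d \<phi> \<epsilon> lam br by fact
  \<comment> \<open>The expansiveness scale \<open>\<delta>\<close> is fixed first; the step length
    \<open>\<eta>\<close> is then chosen so that chains stay within it.\<close>
  obtain \<delta> where \<delta>: "0 < \<delta>" "4 * \<delta> \<le> \<epsilon>"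
    "\<And>x y. \<lbrakk>x \<in> X; y \<in> X; \<And>n. d ((\<phi> ^^ n) x) ((\<phi> ^^ n) y) \<le> 3 * \<delta>\<rbrakk> \<Longrightarrow> br x y = y"
    using forward_expansive by blast
  obtain \<eta> where \<eta>: "0 < \<eta>" "\<eta> \<le> \<delta>"
    "\<And>x c. \<lbrakk>x \<in> X; (x, c) \<in> (stable_step \<eta>)\<^sup>*\<rbrakk> \<Longrightarrow> d x c < \<delta> \<and> br x c = c"
    using stable_chain_bounded[OF assms(4) \<delta>(1)] by blast
  interpret stable_chain_space X d \<phi> \<epsilon> lam br \<delta> \<eta>
    using \<delta> \<eta> by unfold_locales blast+
  show ?thesis
    using compact_Y g_surj local_homeomorphism_g forward_orbit_expansive_g conjugate_solenoid by blast
qed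

end
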